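(* Let $T$ be a complete first-order theory, let $\varphi(x;y)$ be a formula of $T$ and set $\theta(x;y,z)=\varphi(x;y)\wedge\neg\varphi(x;z)$. Let $\langle P_n\rangle$ be the characteristic sequence of $(T,\theta)$. The following are equivalent: (1) $\langle P_n\rangle$ has an $(\omega,2,1)$-array. (2) $\varphi$ has the independence property. (3) $\theta$ has the independence property.
   Context: $x,y,z$ may be tuples of variables; parameters are drawn from a fixed sufficiently saturated (monster) model of $T$. The characteristic sequence of a formula $\theta(x;w)$ is given by $P_n(w_1,\dots,w_n):=\exists x\bigwedge_{i\le n}\theta(x;w_i)$ for $n\ge1$ (here $w=(y,z)$); $P_1$ also denotes the set it defines. For $\lambda\ge\mu$ finite cardinals or $\omega$, $\langle P_n\rangle$ has a $(\lambda,\mu,1)$-array if there exists $X=\{a^m_l:l<\lambda,m<\mu\}\subset P_1$ such that $P_2(a^{m_1}_{l_1},a^{m_2}_{l_2})\iff(l_1=l_2\rightarrow m_1=m_2)$, and for all $1\le n<\omega$, $P_n(a^{m_1}_{l_1},\dots,a^{m_n}_{l_n})\iff\bigwedge_{1\le i,j\le n}P_2(a^{m_i}_{l_i},a^{m_j}_{l_j})$. That is, any (possibly infinite) $C\subset X$ is $P_n$-complete for all $n$ iff it contains no more than one element from each column (fixed lower index $l$). *)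

theory Defs
  imports Main "HOL-Library.Extended_Nat"
begin

unbundle cardinal_syntax

section \<open>First-order logic with equality\<close>

text \<open>
  A language selects its symbols from the types \<^typ>\<open>'f\<close> and \<^typ>\<open>'p\<close>; arities of symbols outside
  \<open>Funs\<close> and \<open>Rels\<close> are irrelevant. Constants are function symbols of arity 0.
\<close>

record ('f, 'p) lang =
  Funs :: "'f set"
  fun_ar :: "'f \<Rightarrow> nat"
  Rels :: "'p set"
  rel_ar :: "'p \<Rightarrow> nat"

text \<open>
  Variables are de Bruijn indices: \<open>Exi p\<close> binds index 0 of \<open>p\<close>, and index \<open>Suc i\<close> of \<open>p\<close>
  denotes the variable \<open>i\<close> of \<open>Exi p\<close>.
\<close>

datatype 'f tm = Var nat | Fun 'f "'f tm list"

datatype ('f, 'p) fm =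
    Top
  | Eq "'f tm" "'f tm"
  | Rel 'p "'f tm list"
  | Neg "('f, 'p) fm"
  | Conj "('f, 'p) fm" "('f, 'p) fm"
  | Exi "('f, 'p) fm"

primrec wf_tm :: "('f, 'p) lang \<Rightarrow> 'f tm \<Rightarrow> bool" where
  "wf_tm L (Var i) \<longleftrightarrow> True"
| "wf_tm L (Fun f ts) \<longleftrightarrow> f \<in> Funs L \<and> length ts = fun_ar L f \<and> list_all (wf_tm L) ts"

primrec wf_fm :: "('f, 'p) lang \<Rightarrow> ('f, 'p) fm \<Rightarrow> bool" where
  "wf_fm L Top \<longleftrightarrow> True"
| "wf_fm L (Eq s t) \<longleftrightarrow> wf_tm L s \<and> wf_tm L t"
| "wf_fm L (Rel R ts) \<longleftrightarrow> R \<in> Rels L \<and> length ts = rel_ar L R \<and> list_all (wf_tm L) ts"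
| "wf_fm L (Neg p) \<longleftrightarrow> wf_fm L p"
| "wf_fm L (Conj p q) \<longleftrightarrow> wf_fm L p \<and> wf_fm L q"
| "wf_fm L (Exi p) \<longleftrightarrow> wf_fm L p"

primrec fv_tm :: "'f tm \<Rightarrow> nat set" where
  "fv_tm (Var i) = {i}"
| "fv_tm (Fun f ts) = \<Union> (set (map fv_tm ts))"

primrec fv :: "('f, 'p) fm \<Rightarrow> nat set" where
  "fv Top = {}"
| "fv (Eq s t) = fv_tm s \<union> fv_tm t"
| "fv (Rel R ts) = \<Union> (set (map fv_tm ts))"
| "fv (Neg p) = fv p"
| "fv (Conj p q) = fv p \<union> fv q"
| "fv (Exi p) = {i. Suc i \<in> fv p}"

definition sentence :: "('f, 'p) lang \<Rightarrow> ('f, 'p) fm \<Rightarrow> bool" where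
  "sentence L p \<longleftrightarrow> wf_fm L p \<and> fv p = {}"

primrec rename_tm :: "(nat \<Rightarrow> nat) \<Rightarrow> 'f tm \<Rightarrow> 'f tm" where
  "rename_tm r (Var i) = Var (r i)"
| "rename_tm r (Fun f ts) = Fun f (map (rename_tm r) ts)"

text \<open>Renaming of the free variables only.\<close>

primrec rename :: "(nat \<Rightarrow> nat) \<Rightarrow> ('f, 'p) fm \<Rightarrow> ('f, 'p) fm" where
  "rename r Top = Top"
| "rename r (Eq s t) = Eq (rename_tm r s) (rename_tm r t)"
| "rename r (Rel R ts) = Rel R (map (rename_tm r) ts)"
| "rename r (Neg p) = Neg (rename r p)"
| "rename r (Conj p q) = Conj (rename r p) (rename r q)"
| "rename r (Exi p) = Exi (rename (case_nat 0 (\<lambda>i. Suc (r i))) p)"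

definition big_conj :: "('f, 'p) fm list \<Rightarrow> ('f, 'p) fm" where
  "big_conj ps = foldr Conj ps Top"

record ('f, 'p, 'a) struct =
  univ :: "'a set"
  fint :: "'f \<Rightarrow> 'a list \<Rightarrow> 'a"
  rint :: "'p \<Rightarrow> 'a list \<Rightarrow> bool"

definition is_struct :: "('f, 'p) lang \<Rightarrow> ('f, 'p, 'a) struct \<Rightarrow> bool" where
  "is_struct L M \<longleftrightarrow> univ M \<noteq> {} \<and>
     (\<forall>f\<in>Funs L. \<forall>as. length as = fun_ar L f \<and> set as \<subseteq> univ M \<longrightarrow> fint M f as \<in> univ M)"

primrec teval :: "('f, 'p, 'a) struct \<Rightarrow> (nat \<Rightarrow> 'a) \<Rightarrow> 'f tm \<Rightarrow> 'a" where
  "teval M e (Var i) = e i"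
| "teval M e (Fun f ts) = fint M f (map (teval M e) ts)"

primrec sat :: "('f, 'p, 'a) struct \<Rightarrow> (nat \<Rightarrow> 'a) \<Rightarrow> ('f, 'p) fm \<Rightarrow> bool" where
  "sat M e Top \<longleftrightarrow> True"
| "sat M e (Eq s t) \<longleftrightarrow> teval M e s = teval M e t"
| "sat M e (Rel R ts) \<longleftrightarrow> rint M R (map (teval M e) ts)"
| "sat M e (Neg p) \<longleftrightarrow> \<not> sat M e p"
| "sat M e (Conj p q) \<longleftrightarrow> sat M e p \<and> sat M e q"
| "sat M e (Exi p) \<longleftrightarrow> (\<exists>a\<in>univ M. sat M (case_nat a e) p)"

text \<open>
  \<open>holds M p as\<close> is satisfaction of \<open>p\<close> by the tuple \<open>as\<close>; it is only meaningful if
  \<open>fv p \<subseteq> {..<length as}\<close>.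
\<close>

definition holds :: "('f, 'p, 'a) struct \<Rightarrow> ('f, 'p) fm \<Rightarrow> 'a list \<Rightarrow> bool" where
  "holds M p as \<longleftrightarrow> sat M (\<lambda>i. as ! i) p"

definition tuples :: "('f, 'p, 'a) struct \<Rightarrow> nat \<Rightarrow> 'a list set" where
  "tuples M n = {as. length as = n \<and> set as \<subseteq> univ M}"

section \<open>Theories and saturated models\<close>

definition models :: "('f, 'p) lang \<Rightarrow> ('f, 'p, 'a) struct \<Rightarrow> ('f, 'p) fm set \<Rightarrow> bool" where
  "models L M T \<longleftrightarrow> is_struct L M \<and> (\<forall>p\<in>T. holds M p [])"

text \<open>
  Semantic consequence cannot quantify over structures on all types. The universes here are the
  nonempty subsets of the type \<^typ>\<open>('f, 'p) fm\<close>, which is infinite and has at least as many elements as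
  there are formulas of the language; by the downward Loewenheim-Skolem theorem this yields the
  same consequence relation as quantifying over all structures.
\<close>

definition entails :: "('f, 'p) lang \<Rightarrow> ('f, 'p) fm set \<Rightarrow> ('f, 'p) fm \<Rightarrow> bool" where
  "entails L T p \<longleftrightarrow>
     (\<forall>N :: ('f, 'p, ('f, 'p) fm) struct. models L N T \<longrightarrow> holds N p [])"

definition complete_theory :: "('f, 'p) lang \<Rightarrow> ('f, 'p) fm set \<Rightarrow> bool" where
  "complete_theory L T \<longleftrightarrow> (\<forall>p\<in>T. sentence L p) \<and> \<not> entails L T (Neg Top) \<and>
     (\<forall>p. sentence L p \<longrightarrow> entails L T p \<or> entails L T (Neg p))"

text \<open>
  A pair \<open>(p, as)\<close> stands for the formula \<open>p(v; as)\<close> in the single variable \<open>v\<close> (index 0) with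
  parameters \<open>as\<close>.
\<close>

definition saturated ::
  "('f, 'p) lang \<Rightarrow> 'k rel \<Rightarrow> ('f, 'p, 'a) struct \<Rightarrow> bool" where
  "saturated L \<kappa> M \<longleftrightarrow>
     (\<forall>A \<Phi>. A \<subseteq> univ M \<and> |A| <o \<kappa> \<and>
        (\<forall>(p, as)\<in>\<Phi>. wf_fm L p \<and> fv p \<subseteq> {..<Suc (length as)} \<and> set as \<subseteq> A) \<and>
        (\<forall>\<Psi>\<subseteq>\<Phi>. finite \<Psi> \<longrightarrow> (\<exists>v\<in>univ M. \<forall>(p, as)\<in>\<Psi>. holds M p (v # as)))
      \<longrightarrow> (\<exists>v\<in>univ M. \<forall>(p, as)\<in>\<Phi>. holds M p (v # as)))"

section \<open>Partitioned formulas, characteristic sequences, arrays, independence\<close>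

text \<open>
  A partitioned formula \<open>p(x; y)\<close> with \<open>x\<close> of length \<open>k\<close> and \<open>y\<close> of length \<open>l\<close> has the variables
  \<open>0, \<dots>, k - 1\<close> for \<open>x\<close> and \<open>k, \<dots>, k + l - 1\<close> for \<open>y\<close>.
\<close>

definition part_fm :: "('f, 'p) lang \<Rightarrow> nat \<Rightarrow> nat \<Rightarrow> ('f, 'p) fm \<Rightarrow> bool" where
  "part_fm L k l p \<longleftrightarrow> wf_fm L p \<and> fv p \<subseteq> {..<k + l}"

text \<open>
  \<open>inst k l i p\<close> is \<open>p(x; w\<^sub>i)\<close>, where \<open>x, w\<^sub>0, w\<^sub>1, \<dots>\<close> are consecutive blocks of variables, \<open>x\<close> of
  length \<open>k\<close> and each \<open>w\<^sub>i\<close> of length \<open>l\<close>.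
\<close>

definition inst :: "nat \<Rightarrow> nat \<Rightarrow> nat \<Rightarrow> ('f, 'p) fm \<Rightarrow> ('f, 'p) fm" where
  "inst k l i p = rename (\<lambda>j. if j < k then j else j + i * l) p"

text \<open>\<open>\<phi>(x; y) \<and> \<not> \<phi>(x; z)\<close>, partitioned as \<open>(x; yz)\<close> with parameter tuple of length \<open>2 * l\<close>.\<close>

definition diff_fm :: "nat \<Rightarrow> nat \<Rightarrow> ('f, 'p) fm \<Rightarrow> ('f, 'p) fm" where
  "diff_fm k l \<phi> = Conj (inst k l 0 \<phi>) (Neg (inst k l 1 \<phi>))"

text \<open>
  For \<open>\<theta>(x; w)\<close> with \<open>x\<close> of length \<open>k\<close> and \<open>w\<close> of length \<open>r\<close>, the formula
  \<open>P\<^sub>n(w\<^sub>0, \<dots>, w\<^sub>n\<^sub>-\<^sub>1)\<close>. After the \<open>k\<close> quantifiers, \<open>w\<^sub>i\<close> consists of the variables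
  \<open>i * r, \<dots>, i * r + r - 1\<close>.
\<close>

definition char_seq :: "nat \<Rightarrow> nat \<Rightarrow> ('f, 'p) fm \<Rightarrow> nat \<Rightarrow> ('f, 'p) fm" where
  "char_seq k r \<theta> n = (Exi ^^ k) (big_conj (map (\<lambda>i. inst k r i \<theta>) [0..<n]))"

definition seq_holds ::
  "('f, 'p, 'a) struct \<Rightarrow> (nat \<Rightarrow> ('f, 'p) fm) \<Rightarrow> 'a list list \<Rightarrow> bool" where
  "seq_holds M P ws \<longleftrightarrow> holds M (P (length ws)) (concat ws)"

text \<open>
  The \<open>(\<lambda>, \<mu>, 1)\<close>-arrays of a sequence \<open>P\<close> whose variables are \<open>r\<close>-tuples; \<open>a l m\<close> is the entry
  in column \<open>l\<close> and row \<open>m\<close>, and the value \<open>\<infinity>\<close> of \<open>\<lambda>\<close> or \<open>\<mu>\<close> stands for \<open>\<omega>\<close>.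
\<close>

definition has_array ::
  "('f, 'p, 'a) struct \<Rightarrow> nat \<Rightarrow> (nat \<Rightarrow> ('f, 'p) fm) \<Rightarrow> enat \<Rightarrow> enat \<Rightarrow> bool" where
  "has_array M r P lam mu \<longleftrightarrow>
     (\<exists>a :: nat \<Rightarrow> nat \<Rightarrow> 'a list.
        let I = {(l, m). enat l < lam \<and> enat m < mu} in
        (\<forall>(l, m)\<in>I. a l m \<in> tuples M r \<and> seq_holds M P [a l m]) \<and>
        (\<forall>(l1, m1)\<in>I. \<forall>(l2, m2)\<in>I.
           seq_holds M P [a l1 m1, a l2 m2] \<longleftrightarrow> (l1 = l2 \<longrightarrow> m1 = m2)) \<and>
        (\<forall>is. is \<noteq> [] \<and> set is \<subseteq> I \<longrightarrow>
           (seq_holds M P (map (\<lambda>(l, m). a l m) is) \<longleftrightarrow>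
            (\<forall>(l1, m1)\<in>set is. \<forall>(l2, m2)\<in>set is. seq_holds M P [a l1 m1, a l2 m2]))))"

definition has_IP :: "('f, 'p, 'a) struct \<Rightarrow> nat \<Rightarrow> nat \<Rightarrow> ('f, 'p) fm \<Rightarrow> bool" where
  "has_IP M k l p \<longleftrightarrow>
     (\<forall>n. \<exists>b :: nat \<Rightarrow> 'a list. (\<forall>i<n. b i \<in> tuples M l) \<and>
        (\<forall>W\<subseteq>{..<n}. \<exists>c\<in>tuples M k. \<forall>i<n. holds M p (c @ b i) \<longleftrightarrow> i \<in> W))"

end

theory Submission
  imports Defs
begin

text \<open>
  The three conditions are proved equivalent in a cycle, from the array to the independence property
  of \<open>\<theta>\<close>, from there to that of \<open>\<phi>\<close>, and back to the array.

  A set of parameters is consistent for \<open>\<theta>\<close> exactly if some single \<open>c\<close> satisfies all the instances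
  (lemma \<open>seq_holds_char_seq\<close>). The two entries of a column of an array with two rows are therefore
  contradictory, while every choice of one entry in each of finitely many columns is realised. For a
  set \<open>W\<close> of columns choose row 0 in the columns in \<open>W\<close> and row 1 in the others: the realisation
  satisfies the row 0 instance exactly at \<open>W\<close>, so row 0 witnesses the independence property of \<open>\<theta>\<close>
  (lemma \<open>has_IP_diff_of_has_array\<close>).

  Suppose \<open>\<theta>\<close> shatters \<open>n\<close> pairs of parameters. The trace on a pair is decided by the \<open>\<phi>\<close>-values of
  its two halves, so \<open>\<phi>\<close> has at least \<open>2\<^sup>n\<close> different traces on these \<open>2n\<close> halves. A family of sets
  shatters at least as many sets as it has members (lemma \<open>card_le_shattered\<close>), but only polynomially
  many subsets of the halves have fewer than \<open>d\<close> elements. Hence for large \<open>n\<close> some set of \<open>d\<close> halves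
  is shattered by \<open>\<phi>\<close> (lemma \<open>has_IP_of_has_IP_diff\<close>).

  Finally let \<open>\<phi>\<close> have the independence property. Saturation turns the arbitrarily long finite
  shattered sequences into an infinite one, \<open>b\<^sub>0, b\<^sub>1, \<dots>\<close> (lemma \<open>has_IP_sequence\<close>). It is
  applied to types in one variable over finitely many parameters: the entries of the tuples are chosen
  one at a time, keeping the property that the finite sequence chosen so far extends to shattered sequences of
  every length. Column \<open>i\<close> of the array consists of the pair \<open>(b\<^sub>2\<^sub>i, b\<^sub>2\<^sub>i\<^sub>+\<^sub>1)\<close> and its reversal,
  which contradict each other, whereas choices in different columns involve disjoint sets of indices
  (lemma \<open>has_array_of_has_IP\<close>).
\<close>

section \<open>Satisfaction, renaming and definable relations\<close>

lemma teval_cong: "(\<And>i. i \<in> fv_tm t \<Longrightarrow> e i = e' i) \<Longrightarrow> teval M e t = teval M e' t"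
proof (induction t)
  case (Fun f ts)
  then have "map (teval M e) ts = map (teval M e') ts"
    by (intro map_cong) auto
  then show ?case by (simp only: teval.simps)
qed auto

lemma sat_cong: "(\<And>i. i \<in> fv p \<Longrightarrow> e i = e' i) \<Longrightarrow> sat M e p \<longleftrightarrow> sat M e' p"
proof (induction p arbitrary: e e')
  case (Eq s t)
  then have "teval M e s = teval M e' s" "teval M e t = teval M e' t"
    by (auto intro: teval_cong)
  then show ?case by (simp only: sat.simps)
next
  case (Rel R ts)
  then have "map (teval M e) ts = map (teval M e') ts"
    by (intro map_cong refl teval_cong) auto
  then show ?case by (simp only: sat.simps)
next
  case (Neg p)
  have "sat M e p \<longleftrightarrow> sat M e' p" by (rule Neg.IH) (simp add: Neg.prems)
  then show ?case by (simp only: sat.simps)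
next
  case (Conj p q)
  have "sat M e p \<longleftrightarrow> sat M e' p" by (rule Conj.IH) (simp add: Conj.prems)
  moreover have "sat M e q \<longleftrightarrow> sat M e' q" by (rule Conj.IH) (simp add: Conj.prems)
  ultimately show ?case by (simp only: sat.simps)
next
  case (Exi p)
  have "sat M (case_nat a e) p \<longleftrightarrow> sat M (case_nat a e') p" for a
    by (rule Exi.IH) (auto split: nat.split intro: Exi.prems)
  then show ?case by (simp only: sat.simps)
qed simp

lemma teval_rename: "teval M e (rename_tm r t) = teval M (\<lambda>i. e (r i)) t"
proof (induction t)
  case (Fun f ts)
  then have "map (teval M e \<circ> rename_tm r) ts = map (teval M (\<lambda>i. e (r i))) ts"
    by (intro map_cong) auto
  then show ?case by (simp only: teval.simps rename_tm.simps map_map)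
qed auto

lemma sat_rename: "sat M e (rename r p) \<longleftrightarrow> sat M (\<lambda>i. e (r i)) p"
proof (induction p arbitrary: e r)
  case (Rel R ts)
  have "map (teval M e \<circ> rename_tm r) ts = map (teval M (\<lambda>i. e (r i))) ts"
    by (simp add: teval_rename)
  then show ?case by (simp only: sat.simps rename.simps map_map)
next
  case (Exi p)
  have "(\<lambda>i. case_nat a e (case_nat 0 (\<lambda>i. Suc (r i)) i)) = case_nat a (\<lambda>i. e (r i))" for a
    by (auto split: nat.split)
  then show ?case by (simp add: Exi.IH)
qed (auto simp: teval_rename)

lemma wf_tm_rename: "wf_tm L t \<Longrightarrow> wf_tm L (rename_tm r t)"
  by (induction t) (auto simp: list_all_iff)

lemma wf_fm_rename: "wf_fm L p \<Longrightarrow> wf_fm L (rename r p)"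
  by (induction p arbitrary: r) (auto simp: list_all_iff wf_tm_rename)

lemma fv_tm_rename: "fv_tm (rename_tm r t) = r ` fv_tm t"
  by (induction t) auto

lemma fv_rename: "fv (rename r p) = r ` fv p"
proof (induction p arbitrary: r)
  case (Exi p)
  have "{i. Suc i \<in> case_nat 0 (\<lambda>i. Suc (r i)) ` A} = r ` {i. Suc i \<in> A}" for A
  proof (intro set_eqI iffI)
    fix i assume "i \<in> {i. Suc i \<in> case_nat 0 (\<lambda>i. Suc (r i)) ` A}"
    then obtain j where "j \<in> A" "Suc i = case_nat 0 (\<lambda>i. Suc (r i)) j" by auto
    then show "i \<in> r ` {i. Suc i \<in> A}" by (cases j) auto
  next
    fix i assume "i \<in> r ` {i. Suc i \<in> A}"
    then obtain j where "Suc j \<in> A" "i = r j" by auto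
    then show "i \<in> {i. Suc i \<in> case_nat 0 (\<lambda>i. Suc (r i)) ` A}"
      by (auto intro!: image_eqI[of _ _ "Suc j"])
  qed
  then show ?case by (simp add: Exi.IH)
qed (auto simp: fv_tm_rename)

text \<open>
  The value of \<open>as ! i\<close> beyond the end of the list is unspecified, so comparing \<open>holds\<close> with \<open>sat\<close>
  in an environment needs the bound on the free variables.
\<close>

lemma holds_cong:
  assumes "fv p \<subseteq> {..<length as}" and "\<And>i. i < length as \<Longrightarrow> e i = as ! i"
  shows "holds M p as \<longleftrightarrow> sat M e p"
  unfolding holds_def using assms by (intro sat_cong) auto

text \<open>
  Definability without parameters of a relation between the elements of an \<open>n\<close>-tuple. Working with its
  closure properties avoids writing down the formulas that express shattering.
\<close>

definition definable ::
  "('f, 'p) lang \<Rightarrow> ('f, 'p, 'a) struct \<Rightarrow> nat \<Rightarrow> ('a list \<Rightarrow> bool) \<Rightarrow> bool" where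
  "definable L M n R \<longleftrightarrow>
     (\<exists>p. wf_fm L p \<and> fv p \<subseteq> {..<n} \<and> (\<forall>as\<in>tuples M n. holds M p as \<longleftrightarrow> R as))"

lemma definable_cong:
  assumes "definable L M n R" "\<And>as. as \<in> tuples M n \<Longrightarrow> R as \<longleftrightarrow> R' as"
  shows "definable L M n R'"
  using assms unfolding definable_def by metis

lemma definable_neg: "definable L M n R \<Longrightarrow> definable L M n (\<lambda>as. \<not> R as)"
  unfolding definable_def
proof (elim exE)
  fix p
  assume "wf_fm L p \<and> fv p \<subseteq> {..<n} \<and> (\<forall>as\<in>tuples M n. holds M p as \<longleftrightarrow> R as)"
  then show "\<exists>p. wf_fm L p \<and> fv p \<subseteq> {..<n} \<and> (\<forall>as\<in>tuples M n. holds M p as \<longleftrightarrow> \<not> R as)"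
    by (intro exI[of _ "Neg p"]) (auto simp: holds_def)
qed

lemma definable_ball:
  assumes "finite I" "\<And>i. i \<in> I \<Longrightarrow> definable L M n (R i)"
  shows "definable L M n (\<lambda>as. \<forall>i\<in>I. R i as)"
  using assms
proof (induction I)
  case empty
  show ?case unfolding definable_def by (intro exI[of _ Top]) (auto simp: holds_def)
next
  case (insert i I)
  have "definable L M n (R i)" "definable L M n (\<lambda>as. \<forall>i\<in>I. R i as)"
    using insert by auto
  then obtain p q where "wf_fm L p" "fv p \<subseteq> {..<n}" "\<forall>as\<in>tuples M n. holds M p as \<longleftrightarrow> R i as"
    and "wf_fm L q" "fv q \<subseteq> {..<n}" "\<forall>as\<in>tuples M n. holds M q as \<longleftrightarrow> (\<forall>i\<in>I. R i as)"
    unfolding definable_def by blast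
  then show ?case
    unfolding definable_def by (intro exI[of _ "Conj p q"]) (auto simp: holds_def)
qed

lemma definable_ex:
  assumes "definable L M (Suc n) R"
  shows "definable L M n (\<lambda>as. \<exists>v\<in>univ M. R (v # as))"
proof -
  obtain p where p: "wf_fm L p" "fv p \<subseteq> {..<Suc n}"
    "\<And>as. as \<in> tuples M (Suc n) \<Longrightarrow> holds M p as \<longleftrightarrow> R as"
    using assms unfolding definable_def by blast
  have "holds M (Exi p) as \<longleftrightarrow> (\<exists>v\<in>univ M. R (v # as))" if as: "as \<in> tuples M n" for as
  proof -
    have "sat M (case_nat v (\<lambda>i. as ! i)) p \<longleftrightarrow> R (v # as)" if "v \<in> univ M" for v
    proof -
      have "holds M p (v # as) \<longleftrightarrow> sat M (case_nat v (\<lambda>i. as ! i)) p"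
        using p(2) as by (intro holds_cong) (auto simp: tuples_def split: nat.split)
      then show ?thesis using p(3)[of "v # as"] as that by (auto simp: tuples_def)
    qed
    then show ?thesis by (auto simp: holds_def)
  qed
  then show ?thesis
    unfolding definable_def using p(1,2) by (intro exI[of _ "Exi p"]) auto
qed

lemma tuples_Suc_iff: "cs \<in> tuples M (Suc m) \<longleftrightarrow> (\<exists>v\<in>univ M. \<exists>bs\<in>tuples M m. cs = v # bs)"
  by (cases cs) (auto simp: tuples_def)

lemma tuples_Cons: "v \<in> univ M \<Longrightarrow> as \<in> tuples M n \<Longrightarrow> v # as \<in> tuples M (Suc n)"
  by (auto simp: tuples_def)

text \<open>
  Quantifiers bind the index 0, that is, the head of the list; so a block of quantifiers projects
  away an initial segment of the tuple.
\<close>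

lemma definable_ex_tuple:
  "definable L M (m + n) R \<Longrightarrow> definable L M n (\<lambda>as. \<exists>cs\<in>tuples M m. R (cs @ as))"
proof (induction m arbitrary: R)
  case 0
  then show ?case by (simp add: tuples_def)
next
  case (Suc m)
  have "definable L M n (\<lambda>as. \<exists>bs\<in>tuples M m. \<exists>v\<in>univ M. R (v # bs @ as))"
    using Suc.IH[OF definable_ex[OF Suc.prems[simplified]]] .
  moreover have "(\<exists>cs\<in>tuples M (Suc m). P cs) \<longleftrightarrow> (\<exists>bs\<in>tuples M m. \<exists>v\<in>univ M. P (v # bs))" for P
    unfolding Bex_def tuples_Suc_iff by blast
  ultimately show ?case by simp
qed

lemma definable_reindex:
  fixes M :: "('f, 'p, 'a) struct"
  assumes "wf_fm L p" "fv p \<subseteq> {..<m}" "\<And>i. i < m \<Longrightarrow> f i < n"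
  shows "definable L M n (\<lambda>as. holds M p (map (\<lambda>i. as ! f i) [0..<m]))"
  unfolding definable_def
proof (intro exI[of _ "rename f p"] conjI ballI)
  fix as :: "'a list"
  show "holds M (rename f p) as = holds M p (map (\<lambda>i. as ! f i) [0..<m])"
    unfolding holds_def sat_rename using assms(2) by (intro sat_cong) auto
qed (use assms in \<open>auto simp: wf_fm_rename fv_rename\<close>)

section \<open>Saturation yields infinite sequences\<close>

text \<open>
  An infinite cardinal exceeds the size of the finite set of entries of \<open>as\<close>, so saturation realises
  the type given by the definable conditions \<open>S m\<close> over \<open>as\<close>.
\<close>

lemma saturated_step:
  fixes M :: "('f, 'p, 'a) struct" and \<kappa> :: "'k rel"
  assumes "saturated L \<kappa> M" "Cinfinite \<kappa>"
    and as: "as \<in> tuples M n"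
    and def: "\<And>m::nat. definable L M (Suc n) (S m)"
    and fin: "\<And>m. \<exists>v\<in>univ M. \<forall>j\<le>m. S j (v # as)"
  shows "\<exists>v\<in>univ M. \<forall>m. S m (v # as)"
proof -
  obtain p where p: "\<And>m. wf_fm L (p m)" "\<And>m. fv (p m) \<subseteq> {..<Suc n}"
    "\<And>m bs. bs \<in> tuples M (Suc n) \<Longrightarrow> holds M (p m) bs \<longleftrightarrow> S m bs"
    using def unfolding definable_def by metis
  have pS: "holds M (p m) (v # as) \<longleftrightarrow> S m (v # as)" if "v \<in> univ M" for m v
    using p(3) tuples_Cons[OF that as] by blast
  let ?\<Phi> = "range (\<lambda>m. (p m, as))"
  have "|set as| <o \<kappa>"
    using assms(2) unfolding cinfinite_def
    by (intro finite_ordLess_infinite[OF card_of_Well_order])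
      (auto simp: Field_card_of dest: card_order_on_well_order_on)
  moreover have "\<exists>v\<in>univ M. \<forall>(q, bs)\<in>\<Psi>. holds M q (v # bs)" if \<Psi>: "\<Psi> \<subseteq> ?\<Phi>" "finite \<Psi>" for \<Psi>
  proof -
    obtain J where J: "finite J" "\<Psi> = (\<lambda>m. (p m, as)) ` J"
      using finite_subset_image[OF \<Psi>(2,1)] by blast
    obtain v where "v \<in> univ M" "\<forall>j\<le>Max J. S j (v # as)" using fin by blast
    then show ?thesis using J pS by (intro bexI[of _ v]) (auto intro: Max_ge)
  qed
  moreover have "set as \<subseteq> univ M" "length as = n" using as by (auto simp: tuples_def)
  ultimately have "\<exists>v\<in>univ M. \<forall>(q, bs)\<in>?\<Phi>. holds M q (v # bs)"
    using assms(1)[unfolded saturated_def, rule_format, of "set as" ?\<Phi>] p(1,2) by auto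
  then show ?thesis using pS by auto
qed

text \<open>
  Compactness for sequences of elements: a coherent family of definable conditions on finite tuples,
  each of them satisfiable, is satisfied by the initial segments of one infinite sequence. Tuples grow
  at the head, where quantifiers bind, so that initial segments appear in reverse order.
\<close>

lemma saturated_sequence:
  fixes M :: "('f, 'p, 'a) struct" and \<kappa> :: "'k rel"
  assumes sat: "saturated L \<kappa> M" "Cinfinite \<kappa>"
    and def: "\<And>n. definable L M n (R n)"
    and mono: "\<And>n v as. length as = n \<Longrightarrow> R (Suc n) (v # as) \<Longrightarrow> R n as"
    and ex: "\<And>n. \<exists>as\<in>tuples M n. R n as"
  shows "\<exists>e. \<forall>n. e n \<in> univ M \<and> R n (rev (map e [0..<n]))"
proof -
  \<comment> \<open>The invariant of the construction: extensions to every greater length exist. Satisfaction of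
    \<open>R n as\<close> alone need not be preserved by any further element.\<close>
  define G where "G n as \<longleftrightarrow> as \<in> tuples M n \<and> (\<forall>m. \<exists>cs\<in>tuples M m. R (m + n) (cs @ as))"
    for n as
  have mono': "length as = n \<Longrightarrow> R (length cs + n) (cs @ as) \<Longrightarrow> R n as" for cs n as
    by (induction cs) (auto dest: mono[rotated])
  have G0: "G 0 []" using ex by (auto simp: G_def tuples_def)
  have step: "\<exists>v\<in>univ M. G (Suc n) (v # as)" if G: "G n as" for n as
  proof -
    let ?S = "\<lambda>m bs. \<exists>cs\<in>tuples M m. R (m + Suc n) (cs @ bs)"
    have as: "as \<in> tuples M n" using G by (simp add: G_def)
    have "\<exists>v\<in>univ M. \<forall>j\<le>m. ?S j (v # as)" for m
    proof -
      \<comment> \<open>The conditions get stronger with \<open>j\<close>, so one long extension of \<open>as\<close> handles all \<open>j \<le> m\<close>;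
        its element next to \<open>as\<close> is the desired one.\<close>
      obtain cs where cs: "cs \<in> tuples M (Suc m)" "R (Suc m + n) (cs @ as)"
        using G unfolding G_def by blast
      then obtain ds v where v: "cs = ds @ [v]" "v \<in> univ M" "ds \<in> tuples M m"
        by (cases cs rule: rev_cases) (auto simp: tuples_def)
      have "?S j (v # as)" if "j \<le> m" for j
      proof -
        let ?d = "take (m - j) ds" and ?u = "drop (m - j) ds"
        have "R (length ?d + (j + Suc n)) (?d @ ?u @ v # as)"
          using cs(2) v that unfolding append_assoc[symmetric] append_take_drop_id
          by (simp add: tuples_def)
        moreover have "length (?u @ v # as) = j + Suc n"
          using v(3) as that by (simp add: tuples_def)
        ultimately have "R (j + Suc n) (?u @ v # as)" by (rule mono'[rotated])
        moreover have "?u \<in> tuples M j"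
          using v(3) that set_drop_subset[of "m - j" ds] by (auto simp: tuples_def)
        ultimately show ?thesis by blast
      qed
      then show ?thesis using v(2) by blast
    qed
    then have "\<exists>v\<in>univ M. \<forall>m. ?S m (v # as)"
      using saturated_step[OF sat as, of ?S] definable_ex_tuple[OF def] by blast
    then show ?thesis using tuples_Cons[OF _ as] unfolding G_def by blast
  qed
  obtain s where s: "\<And>n. G n (s n)" "\<And>n. \<exists>v\<in>univ M. s (Suc n) = v # s n"
    using dependent_nat_choice[of G "\<lambda>n as bs. \<exists>v\<in>univ M. bs = v # as"] G0 step by metis
  define e where "e n = hd (s (Suc n))" for n
  have "s n = rev (map e [0..<n])" for n
  proof (induction n)
    case 0
    then show ?case using s(1)[of 0] by (simp add: G_def tuples_def)
  next
    case (Suc n)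
    then show ?case using s(2)[of n] by (auto simp: e_def)
  qed
  moreover have "R n (s n)" for n
  proof -
    obtain cs where "cs \<in> tuples M 0" "R (0 + n) (cs @ s n)" using s(1)[of n] unfolding G_def by blast
    then show ?thesis by (simp add: tuples_def)
  qed
  moreover have "e n \<in> univ M" for n using s(2)[of n] by (auto simp: e_def)
  ultimately show ?thesis by metis
qed

section \<open>Characteristic sequences\<close>

text \<open>
  The outermost of the \<open>k\<close> quantifiers binds the index \<open>k - 1\<close>, which is why its witness is the last
  entry of \<open>cs\<close>.
\<close>

lemma sat_Exi_funpow:
  "sat M e ((Exi ^^ k) p) \<longleftrightarrow> (\<exists>cs\<in>tuples M k. sat M (\<lambda>i. if i < k then cs ! i else e (i - k)) p)"
proof (induction k arbitrary: e)
  case 0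
  then show ?case by (simp add: tuples_def)
next
  case (Suc k)
  let ?env = "\<lambda>cs i. if i < Suc k then cs ! i else e (i - Suc k)"
  have env: "(\<lambda>i. if i < k then cs ! i else case_nat v e (i - k)) = ?env (cs @ [v])"
    if "cs \<in> tuples M k" for cs v
  proof
    fix i
    consider "i < k" | "i = k" | "i > k" by linarith
    then show "(if i < k then cs ! i else case_nat v e (i - k)) = ?env (cs @ [v]) i"
    proof cases
      case 3
      then have "i - k = Suc (i - Suc k)" by simp
      with 3 show ?thesis by simp
    qed (use that in \<open>auto simp: nth_append tuples_def\<close>)
  qed
  have snoc: "cs \<in> tuples M (Suc k) \<longleftrightarrow> (\<exists>v\<in>univ M. \<exists>ds\<in>tuples M k. cs = ds @ [v])" for cs
    by (cases cs rule: rev_cases) (auto simp: tuples_def)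
  have "sat M e ((Exi ^^ Suc k) p) \<longleftrightarrow>
      (\<exists>v\<in>univ M. \<exists>cs\<in>tuples M k. sat M (?env (cs @ [v])) p)"
    by (simp add: Suc.IH env cong: bex_cong)
  also have "\<dots> \<longleftrightarrow> (\<exists>cs\<in>tuples M (Suc k). sat M (?env cs) p)"
    unfolding Bex_def snoc by blast
  finally show ?case .
qed

lemma sat_big_conj: "sat M e (big_conj ps) \<longleftrightarrow> (\<forall>p\<in>set ps. sat M e p)"
  by (induction ps) (auto simp: big_conj_def)

lemma nth_concat_blocks:
  assumes "\<forall>w\<in>set ws. length w = r" "i < length ws" "j < r"
  shows "concat ws ! (i * r + j) = ws ! i ! j"
  using assms
proof (induction ws arbitrary: i)
  case (Cons w ws)
  then show ?case by (cases i) (auto simp: nth_append add.assoc)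
qed simp

lemma seq_holds_char_seq:
  assumes "part_fm L k r \<theta>" "set ws \<subseteq> tuples M r"
  shows "seq_holds M (char_seq k r \<theta>) ws \<longleftrightarrow> (\<exists>c\<in>tuples M k. \<forall>w\<in>set ws. holds M \<theta> (c @ w))"
proof -
  have len: "\<forall>w\<in>set ws. length w = r" using assms(2) by (auto simp: tuples_def)
  let ?env = "\<lambda>c i. if i < k then c ! i else concat ws ! (i - k)"
  have inst: "sat M (?env c) (inst k r i \<theta>) \<longleftrightarrow> holds M \<theta> (c @ ws ! i)"
    if c: "c \<in> tuples M k" and i: "i < length ws" for c i
    unfolding inst_def sat_rename
  proof (rule holds_cong[symmetric])
    have lw: "length (ws ! i) = r" "length c = k" using len i c by (auto simp: tuples_def)
    then show "fv \<theta> \<subseteq> {..<length (c @ ws ! i)}" using assms(1) by (simp add: part_fm_def)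
    fix j assume "j < length (c @ ws ! i)"
    moreover have "concat ws ! (j + i * r - k) = ws ! i ! (j - k)" if "\<not> j < k" "j < k + r"
      using nth_concat_blocks[OF len i, of "j - k"] that by (simp add: algebra_simps)
    ultimately show "?env c (if j < k then j else j + i * r) = (c @ ws ! i) ! j"
      using lw by (auto simp: nth_append)
  qed
  show ?thesis
    unfolding seq_holds_def char_seq_def holds_def[of M "(Exi ^^ k) _"] sat_Exi_funpow sat_big_conj
    by (intro bex_cong refl) (auto simp: inst all_set_conv_all_nth)
qed

lemma part_fm_diff_fm: "part_fm L k l \<phi> \<Longrightarrow> part_fm L k (2 * l) (diff_fm k l \<phi>)"
  unfolding part_fm_def diff_fm_def inst_def
  by (auto simp: wf_fm_rename fv_rename)

lemma holds_diff_fm: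
  assumes "part_fm L k l \<phi>" "c \<in> tuples M k" "y \<in> tuples M l" "z \<in> tuples M l"
  shows "holds M (diff_fm k l \<phi>) (c @ y @ z) \<longleftrightarrow> holds M \<phi> (c @ y) \<and> \<not> holds M \<phi> (c @ z)"
proof -
  have len: "length c = k" "length y = l" "length z = l" using assms by (auto simp: tuples_def)
  have fv: "fv \<phi> \<subseteq> {..<k + l}" using assms(1) by (simp add: part_fm_def)
  have "holds M \<phi> (c @ y) \<longleftrightarrow> sat M (\<lambda>i. (c @ y @ z) ! i) (inst k l 0 \<phi>)"
    unfolding inst_def sat_rename using len fv by (intro holds_cong) (auto simp: nth_append)
  moreover have "holds M \<phi> (c @ z) \<longleftrightarrow> sat M (\<lambda>i. (c @ y @ z) ! i) (inst k l 1 \<phi>)"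
    unfolding inst_def sat_rename using len fv by (intro holds_cong) (auto simp: nth_append)
  ultimately show ?thesis by (simp add: diff_fm_def holds_def[of M "Conj _ _"])
qed

section \<open>Infinite shattered sequences\<close>

text \<open>There is only one empty tuple, and a repeated parameter cannot be separated from itself.\<close>

lemma has_IP_length_pos:
  assumes "has_IP M k l p"
  shows "0 < l"
proof (rule ccontr)
  assume "\<not> 0 < l"
  obtain b where b: "\<forall>i<2::nat. b i \<in> tuples M l"
    and W: "\<forall>W\<subseteq>{..<2::nat}. \<exists>c\<in>tuples M k. \<forall>i<2. holds M p (c @ b i) \<longleftrightarrow> i \<in> W"
    using assms unfolding has_IP_def by blast
  have "{0} \<subseteq> {..<2::nat}" by simp
  then obtain c where "\<forall>i<2::nat. holds M p (c @ b i) \<longleftrightarrow> i \<in> {0}" using W by blast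
  then have "holds M p (c @ b 0)" "\<not> holds M p (c @ b 1)" by simp_all
  moreover have "b 0 = b 1" using b \<open>\<not> 0 < l\<close> by (simp add: tuples_def)
  ultimately show False by simp
qed

text \<open>
  A sequence of \<open>l\<close>-tuples is flattened to a sequence of elements, listed with the latest element
  first to match the order of growth in \<open>saturated_sequence\<close>.
\<close>

definition block :: "nat \<Rightarrow> nat \<Rightarrow> 'a list \<Rightarrow> 'a list" where
  "block l i as = map (\<lambda>j. rev as ! (i * l + j)) [0..<l]"

text \<open>
  Only the \<open>n div l\<close> completed blocks of a list of length \<open>n\<close> are constrained; this makes sense of
  the condition for every \<open>n\<close>, so that elements can be added one by one.
\<close>

definition blocks_shattered ::
  "('f, 'p, 'a) struct \<Rightarrow> nat \<Rightarrow> nat \<Rightarrow> ('f, 'p) fm \<Rightarrow> nat \<Rightarrow> 'a list \<Rightarrow> bool" where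
  "blocks_shattered M k l \<phi> n as \<longleftrightarrow> (\<forall>W\<in>Pow {..<n div l}.
     \<exists>c\<in>tuples M k. \<forall>i\<in>{..<n div l}. holds M \<phi> (c @ block l i as) \<longleftrightarrow> i \<in> W)"

lemma block_index_less:
  assumes "i < n div l" "j < l"
  shows "i * l + j < (n :: nat)"
proof -
  have "i * l + j < Suc i * l" using assms(2) by simp
  also have "\<dots> \<le> n div l * l" using assms(1) by (intro mult_right_mono) auto
  also have "\<dots> \<le> n" by simp
  finally show ?thesis .
qed

lemma definable_blocks_shattered:
  fixes M :: "('f, 'p, 'a) struct"
  assumes \<phi>: "part_fm L k l \<phi>"
  shows "definable L M n (blocks_shattered M k l \<phi> n)"
proof -
  \<comment> \<open>The variable of \<open>c @ as\<close> that takes the place of variable \<open>j\<close> of \<open>\<phi>\<close> for the block \<open>i\<close>; the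
    subtraction from \<open>n\<close> undoes the reversal in \<open>block\<close>.\<close>
  define f where "f i j = (if j < k then j else k + (n - Suc (i * l + (j - k))))" for i j
  define D where "D i ds \<longleftrightarrow> holds M \<phi> (map (\<lambda>j. ds ! f i j) [0..<k + l])"
    for i and ds :: "'a list"
  have f: "f i j < k + n" if "i < n div l" "j < k + l" for i j
    using that by (cases n) (auto simp: f_def)
  have D: "definable L M (k + n) (D i)" if "i < n div l" for i
    unfolding D_def using \<phi> f[OF that] by (intro definable_reindex) (auto simp: part_fm_def)
  have "definable L M (k + n) (\<lambda>ds. D i ds \<longleftrightarrow> i \<in> W)" if "i < n div l" for i W
    using D[OF that] definable_neg[OF D[OF that]] by (cases "i \<in> W") simp_all
  then have "definable L M (k + n) (\<lambda>ds. \<forall>i\<in>{..<n div l}. D i ds \<longleftrightarrow> i \<in> W)" for W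
    by (intro definable_ball) simp_all
  then have "definable L M n (\<lambda>as. \<exists>c\<in>tuples M k. \<forall>i\<in>{..<n div l}. D i (c @ as) \<longleftrightarrow> i \<in> W)" for W
    by (rule definable_ex_tuple)
  then have def: "definable L M n (\<lambda>as. \<forall>W\<in>Pow {..<n div l}. \<exists>c\<in>tuples M k.
      \<forall>i\<in>{..<n div l}. D i (c @ as) \<longleftrightarrow> i \<in> W)"
    by (intro definable_ball) simp_all
  have reindex: "D i (c @ as) \<longleftrightarrow> holds M \<phi> (c @ block l i as)"
    if i: "i < n div l" and as: "length as = n" and c: "c \<in> tuples M k" for i as c
  proof -
    have ck: "length c = k" using c by (simp add: tuples_def)
    have "map (\<lambda>j. (c @ as) ! f i j) [0..<k + l] = c @ block l i as"
    proof (rule nth_equalityI)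
      show "length (map (\<lambda>j. (c @ as) ! f i j) [0..<k + l]) = length (c @ block l i as)"
        using ck by (simp add: block_def)
      fix j assume "j < length (map (\<lambda>j. (c @ as) ! f i j) [0..<k + l])"
      then have j: "j < k + l" by simp
      then have "map (\<lambda>j. (c @ as) ! f i j) [0..<k + l] ! j = (c @ as) ! f i j"
        by (simp del: upt_add_eq_append)
      also have "\<dots> = (c @ block l i as) ! j"
      proof (cases "j < k")
        case True
        then show ?thesis using ck by (simp add: f_def nth_append)
      next
        case False
        then have jl: "j - k < l" using j by simp
        have "(c @ as) ! f i j = as ! (n - Suc (i * l + (j - k)))"
          using False ck by (simp add: f_def nth_append)
        also have "\<dots> = rev as ! (i * l + (j - k))"
          using block_index_less[OF i jl] as by (simp add: rev_nth)
        also have "\<dots> = (c @ block l i as) ! j"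
          using False ck jl by (simp add: block_def nth_append)
        finally show ?thesis .
      qed
      finally show "map (\<lambda>j. (c @ as) ! f i j) [0..<k + l] ! j = (c @ block l i as) ! j" .
    qed
    then show ?thesis by (simp only: D_def)
  qed
  show ?thesis
  proof (rule definable_cong[OF def])
    fix as assume "as \<in> tuples M n"
    then have "length as = n" by (simp add: tuples_def)
    then show "(\<forall>W\<in>Pow {..<n div l}. \<exists>c\<in>tuples M k.
        \<forall>i\<in>{..<n div l}. D i (c @ as) \<longleftrightarrow> i \<in> W) \<longleftrightarrow> blocks_shattered M k l \<phi> n as"
      unfolding blocks_shattered_def
      by (intro ball_cong bex_cong refl) (simp add: reindex)
  qed
qed

lemma blocks_shattered_Cons:
  assumes "length as = n" "blocks_shattered M k l \<phi> (Suc n) (v # as)"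
  shows "blocks_shattered M k l \<phi> n as"
  unfolding blocks_shattered_def
proof
  fix W assume W: "W \<in> Pow {..<n div l}"
  have le: "n div l \<le> Suc n div l" by (intro div_le_mono) simp
  have blk: "block l i (v # as) = block l i as" if "i < n div l" for i
    using block_index_less[OF that] assms(1) by (simp add: block_def nth_append)
  have sub: "{..<n div l} \<subseteq> {..<Suc n div l}" using le by simp
  have "W \<in> Pow {..<Suc n div l}" using PowD[OF W] sub by (intro PowI) (rule subset_trans)
  from assms(2)[unfolded blocks_shattered_def, THEN bspec, OF this]
  obtain c where c: "c \<in> tuples M k"
    "\<forall>i\<in>{..<Suc n div l}. holds M \<phi> (c @ block l i (v # as)) \<longleftrightarrow> i \<in> W" ..
  have "holds M \<phi> (c @ block l i as) \<longleftrightarrow> i \<in> W" if i: "i \<in> {..<n div l}" for i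
    using bspec[OF c(2) subsetD[OF sub i]] blk[of i] i by simp
  with c(1) show "\<exists>c\<in>tuples M k. \<forall>i\<in>{..<n div l}. holds M \<phi> (c @ block l i as) \<longleftrightarrow> i \<in> W"
    by blast
qed

lemma blocks_shattered_exists:
  assumes IP: "has_IP M k l \<phi>" and l: "0 < l"
  shows "\<exists>as\<in>tuples M n. blocks_shattered M k l \<phi> n as"
proof -
  obtain b where b: "\<forall>i<n. b i \<in> tuples M l"
    and c: "\<forall>W\<subseteq>{..<n}. \<exists>c\<in>tuples M k. \<forall>i<n. holds M \<phi> (c @ b i) \<longleftrightarrow> i \<in> W"
    using IP unfolding has_IP_def by blast
  let ?bs = "map b [0..<n]"
  define as where "as = rev (take n (concat ?bs))"
  have bl: "\<forall>w\<in>set ?bs. length w = l" using b by (auto simp: tuples_def)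
  have "map length ?bs = map (\<lambda>_. l) ?bs" using bl by (intro map_cong) auto
  then have "length (concat ?bs) = n * l"
    by (simp only: length_concat sum_list_triv) simp
  then have len: "length as = n" using l by (simp add: as_def)
  have "set as \<subseteq> set (concat ?bs)" using set_take_subset by (simp add: as_def del: set_concat)
  also have "\<dots> \<subseteq> univ M" using b by (auto simp: tuples_def)
  finally have as: "as \<in> tuples M n" using len by (simp add: tuples_def)
  have le: "n div l \<le> n" by simp
  have blk: "block l i as = b i" if i: "i < n div l" for i
  proof (rule nth_equalityI)
    have i_n: "i < n" using i le by linarith
    then show "length (block l i as) = length (b i)" using b by (simp add: block_def tuples_def)
    fix j assume "j < length (block l i as)"
    then have j: "j < l" by (simp add: block_def)
    have "block l i as ! j = concat ?bs ! (i * l + j)"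
      using block_index_less[OF i j] j by (simp add: block_def as_def)
    also have "\<dots> = b i ! j"
      using nth_concat_blocks[OF bl, of i j] i_n j by simp
    finally show "block l i as ! j = b i ! j" .
  qed
  have "blocks_shattered M k l \<phi> n as" unfolding blocks_shattered_def
  proof
    fix W assume W: "W \<in> Pow {..<n div l}"
    have sub: "{..<n div l} \<subseteq> {..<n}" using le by simp
    have "W \<subseteq> {..<n}" using PowD[OF W] sub by (rule subset_trans)
    then obtain d where "d \<in> tuples M k" "\<forall>i<n. holds M \<phi> (d @ b i) \<longleftrightarrow> i \<in> W"
      using c by blast
    moreover have "i < n" if "i \<in> {..<n div l}" for i using that le by (simp only: lessThan_iff)
    ultimately show "\<exists>c\<in>tuples M k. \<forall>i\<in>{..<n div l}. holds M \<phi> (c @ block l i as) \<longleftrightarrow> i \<in> W"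
      by (intro bexI[of _ d] ballI) (simp_all add: blk)
  qed
  with as show ?thesis by blast
qed

text \<open>
  Independence provides a shattered sequence for each finite length separately; saturation makes a
  single sequence serve for all lengths.
\<close>

lemma has_IP_sequence:
  fixes M :: "('f, 'p, 'a) struct" and \<kappa> :: "'k rel"
  assumes sat: "saturated L \<kappa> M" "Cinfinite \<kappa>"
    and \<phi>: "part_fm L k l \<phi>" and IP: "has_IP M k l \<phi>"
  shows "\<exists>b. (\<forall>i. b i \<in> tuples M l) \<and>
    (\<forall>n. \<forall>W\<subseteq>{..<n::nat}. \<exists>c\<in>tuples M k. \<forall>i<n. holds M \<phi> (c @ b i) \<longleftrightarrow> i \<in> W)"
proof -
  have l: "0 < l" using IP by (rule has_IP_length_pos)
  let ?R = "blocks_shattered M k l \<phi>"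
  have "\<exists>e. \<forall>n. e n \<in> univ M \<and> ?R n (rev (map e [0..<n]))"
    by (rule saturated_sequence[OF sat])
      (fact definable_blocks_shattered[OF \<phi>] blocks_shattered_Cons blocks_shattered_exists[OF IP l])+
  then obtain e where e: "\<And>n. e n \<in> univ M" "\<And>n. ?R n (rev (map e [0..<n]))" by blast
  define b where "b i = map (\<lambda>j. e (i * l + j)) [0..<l]" for i
  have "b i \<in> tuples M l" for i using e(1) by (auto simp: b_def tuples_def)
  moreover have "\<exists>c\<in>tuples M k. \<forall>i<n. holds M \<phi> (c @ b i) \<longleftrightarrow> i \<in> W" if W: "W \<subseteq> {..<n}" for n W
  proof -
    have n: "n * l div l = n" using l by simp
    have blk: "block l i (rev (map e [0..<n * l])) = b i" if "i < n" for i
      using block_index_less[of i "n * l" l] that n by (simp add: block_def b_def)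
    have "W \<in> Pow {..<n}" using W by simp
    from e(2)[of "n * l", unfolded blocks_shattered_def n, THEN bspec, OF this]
    obtain c where "c \<in> tuples M k"
      "\<forall>i\<in>{..<n}. holds M \<phi> (c @ block l i (rev (map e [0..<n * l]))) \<longleftrightarrow> i \<in> W" ..
    then show ?thesis using blk by auto
  qed
  ultimately show ?thesis by blast
qed

section \<open>Counting shattered sets\<close>

definition shatters :: "'b set set \<Rightarrow> 'b set \<Rightarrow> bool" where
  "shatters F S \<longleftrightarrow> (\<forall>W\<subseteq>S. \<exists>A\<in>F. A \<inter> S = W)"

text \<open>
  Pajor's form of the Sauer--Shelah lemma. Split \<open>F\<close> into the members without a point \<open>x\<close> and those
  with it, the latter with \<open>x\<close> removed. A set shattered by either part is shattered by \<open>F\<close>, and one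
  shattered by both remains so after adding \<open>x\<close>, so nothing is lost when the two counts are added.
\<close>

lemma card_le_shattered:
  assumes "finite X" "F \<subseteq> Pow X"
  shows "card F \<le> card {S. S \<subseteq> X \<and> shatters F S}"
  using assms
proof (induction X arbitrary: F)
  case empty
  have none: "{S. S \<subseteq> {} \<and> shatters {{}} S} = {{}}" by (auto simp: shatters_def)
  from empty consider "F = {}" | "F = {{}}" by auto
  then show ?case
  proof cases
    case 2
    show ?thesis unfolding 2 none ..
  qed simp
next
  case (insert x X)
  let ?Sh = "\<lambda>F. {S. S \<subseteq> X \<and> shatters F S}"
  define F0 where "F0 = {A \<in> F. x \<notin> A}"
  define F1 where "F1 = {A. x \<notin> A \<and> insert x A \<in> F}"
  have fin: "finite F0" "finite F1" "finite (?Sh F0)" "finite (?Sh F1)"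
  proof -
    have "F0 \<subseteq> Pow (insert x X)" "F1 \<subseteq> Pow (insert x X)"
      using insert.prems by (auto simp: F0_def F1_def)
    then show "finite F0" "finite F1" using insert.hyps by (auto intro: finite_subset)
    show "finite (?Sh F0)" "finite (?Sh F1)" using insert.hyps by auto
  qed
  have Feq: "F = F0 \<union> insert x ` F1"
  proof
    show "F \<subseteq> F0 \<union> insert x ` F1"
    proof
      fix A assume "A \<in> F"
      then show "A \<in> F0 \<union> insert x ` F1"
        by (cases "x \<in> A") (auto simp: F0_def F1_def image_iff insert_absorb intro!: exI[of _ "A - {x}"])
    qed
  qed (auto simp: F0_def F1_def)
  have inj: "inj_on (insert x) G" if "\<And>A. A \<in> G \<Longrightarrow> x \<notin> A" for G
    using that by (intro inj_onI) (simp add: insert_ident)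
  have "card F = card F0 + card (insert x ` F1)"
    unfolding Feq using fin by (intro card_Un_disjoint) (auto simp: F0_def)
  also have "card (insert x ` F1) = card F1"
    by (intro card_image inj) (auto simp: F1_def)
  also have "card F0 + card F1 \<le> card (?Sh F0) + card (?Sh F1)"
    using insert.prems insert.hyps
    by (intro add_mono insert.IH) (auto simp: F0_def F1_def)
  also have "\<dots> = card (?Sh F0 \<union> ?Sh F1) + card (?Sh F0 \<inter> ?Sh F1)"
    using fin by (intro card_Un_Int)
  also have "card (?Sh F0 \<inter> ?Sh F1) = card (insert x ` (?Sh F0 \<inter> ?Sh F1))"
    using insert.hyps by (intro card_image[symmetric] inj) auto
  also have "card (?Sh F0 \<union> ?Sh F1) + \<dots> =
      card ((?Sh F0 \<union> ?Sh F1) \<union> insert x ` (?Sh F0 \<inter> ?Sh F1))"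
    using fin insert.hyps by (intro card_Un_disjoint[symmetric]) auto
  also have "\<dots> \<le> card {S. S \<subseteq> insert x X \<and> shatters F S}"
  proof (rule card_mono)
    show "finite {S. S \<subseteq> insert x X \<and> shatters F S}" using insert.hyps by auto
    have "shatters F S" if "S \<subseteq> X" "shatters F0 S" for S
      using that unfolding shatters_def F0_def by blast
    moreover have "shatters F S" if S: "S \<subseteq> X" "shatters F1 S" for S
      unfolding shatters_def
    proof (intro allI impI)
      fix W assume "W \<subseteq> S"
      then obtain A where "A \<in> F1" "A \<inter> S = W" using S unfolding shatters_def by blast
      then show "\<exists>A\<in>F. A \<inter> S = W"
        using S(1) insert.hyps by (intro bexI[of _ "insert x A"]) (auto simp: F1_def)
    qed
    moreover have "shatters F (insert x S)" if S: "S \<subseteq> X" "shatters F0 S" "shatters F1 S" for S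
      unfolding shatters_def
    proof (intro allI impI)
      fix W assume W: "W \<subseteq> insert x S"
      have xS: "x \<notin> S" using S(1) insert.hyps by auto
      show "\<exists>A\<in>F. A \<inter> insert x S = W"
      proof (cases "x \<in> W")
        case True
        have "W - {x} \<subseteq> S" using W by auto
        then obtain A where "A \<in> F1" "A \<inter> S = W - {x}" using S(3) unfolding shatters_def by blast
        then show ?thesis
          using True xS by (intro bexI[of _ "insert x A"]) (auto simp: F1_def)
      next
        case False
        then have "W \<subseteq> S" using W by auto
        then obtain A where "A \<in> F0" "A \<inter> S = W" using S(2) unfolding shatters_def by blast
        then show ?thesis by (intro bexI[of _ A]) (auto simp: F0_def)
      qed
    qed
    ultimately show "(?Sh F0 \<union> ?Sh F1) \<union> insert x ` (?Sh F0 \<inter> ?Sh F1)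
        \<subseteq> {S. S \<subseteq> insert x X \<and> shatters F S}" by auto
  qed
  finally show ?case .
qed

text \<open>
  A set with fewer than \<open>d\<close> elements is listed by a sequence of length \<open>d\<close> that is padded with the
  point \<open>m\<close>, which is not in the ground set.
\<close>

lemma card_small_subsets:
  "card {S. S \<subseteq> {..<m::nat} \<and> card S < d} \<le> (m + 1) ^ d"
proof -
  let ?L = "{xs. set xs \<subseteq> {..m} \<and> length xs = d}"
  have "{S. S \<subseteq> {..<m} \<and> card S < d} \<subseteq> (\<lambda>xs. set xs - {m}) ` ?L"
  proof
    fix S assume S: "S \<in> {S. S \<subseteq> {..<m} \<and> card S < d}"
    then have "finite S" using finite_subset by blast
    then obtain ys where ys: "set ys = S" "distinct ys" using finite_distinct_list by blast
    then have "length ys < d" using S distinct_card[of ys] by auto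
    then show "S \<in> (\<lambda>xs. set xs - {m}) ` ?L"
      using S ys by (intro image_eqI[of _ _ "ys @ replicate (d - length ys) m"]) auto
  qed
  then have "card {S. S \<subseteq> {..<m} \<and> card S < d} \<le> card ?L"
    using finite_lists_length_eq[of "{..m}" d] by (auto intro: surj_card_le)
  then show ?thesis by (simp add: card_lists_length_eq)
qed

lemma power_eventually_beats_poly: "\<exists>n. (2 * n + 1) ^ d < (2::nat) ^ n"
proof -
  \<comment> \<open>For \<open>n = 2 ^ t\<close> the left side is at most \<open>2 ^ (d * (t + 2))\<close>, so \<open>d * (t + 2) < 2 ^ t\<close> suffices.\<close>
  let ?t = "4 * d"
  let ?n = "(2::nat) ^ ?t"
  have "d * (?t + 2) < (2 * d + 1) * (2 * d + 1)" by (simp add: algebra_simps)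
  also have "2 * d + 1 \<le> 2 ^ (2 * d)" using less_exp[of "2 * d"] by linarith
  then have "(2 * d + 1) * (2 * d + 1) \<le> 2 ^ (2 * d) * 2 ^ (2 * d)" by (intro mult_mono) auto
  also have "\<dots> = ?n" by (simp flip: power_add)
  finally have less: "d * (?t + 2) < ?n" .
  have "1 \<le> ?n" by simp
  then have "2 * ?n + 1 \<le> 2 ^ (?t + 2)" unfolding power_add by simp
  then have "(2 * ?n + 1) ^ d \<le> (2 ^ (?t + 2)) ^ d" by (intro power_mono) auto
  also have "\<dots> = 2 ^ (d * (?t + 2))" by (simp only: power_mult[symmetric] mult.commute)
  also have "\<dots> < 2 ^ ?n" using less by (intro power_strict_increasing) auto
  finally show ?thesis by blast
qed

section \<open>Arrays and independence\<close>

lemma has_IP_of_has_IP_diff: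
  assumes \<phi>: "part_fm L k l \<phi>" and IP: "has_IP M k (2 * l) (diff_fm k l \<phi>)"
  shows "has_IP M k l \<phi>"
  unfolding has_IP_def
proof
  fix d
  obtain n where n: "(2 * n + 1) ^ d < (2::nat) ^ n" using power_eventually_beats_poly by blast
  obtain w where w: "\<forall>i<n. w i \<in> tuples M (2 * l)"
    and "\<forall>W\<subseteq>{..<n}. \<exists>c\<in>tuples M k. \<forall>i<n. holds M (diff_fm k l \<phi>) (c @ w i) \<longleftrightarrow> i \<in> W"
    using IP unfolding has_IP_def by blast
  then obtain c where c: "\<And>W. W \<subseteq> {..<n} \<Longrightarrow> c W \<in> tuples M k"
    and cw: "\<And>W i. W \<subseteq> {..<n} \<Longrightarrow> i < n \<Longrightarrow> holds M (diff_fm k l \<phi>) (c W @ w i) \<longleftrightarrow> i \<in> W"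
    by metis
  \<comment> \<open>The halves are counted by index, so it does not matter whether some of them coincide.\<close>
  define p where "p j = (if even j then take l (w (j div 2)) else drop l (w (j div 2)))" for j
  have p: "p j \<in> tuples M l" if "j < 2 * n" for j
  proof -
    have "w (j div 2) \<in> tuples M (2 * l)" using w that by auto
    then show ?thesis
      using set_take_subset[of l "w (j div 2)"] set_drop_subset[of l "w (j div 2)"]
      by (auto simp: p_def tuples_def)
  qed
  define tr where "tr W = {j. j < 2 * n \<and> holds M \<phi> (c W @ p j)}" for W
  have tr: "i \<in> W \<longleftrightarrow> 2 * i \<in> tr W \<and> 2 * i + 1 \<notin> tr W" if W: "W \<subseteq> {..<n}" and i: "i < n" for W i
  proof -
    have "w i = p (2 * i) @ p (2 * i + 1)" by (simp add: p_def)
    then show ?thesis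
      using cw[OF W i] holds_diff_fm[OF \<phi> c[OF W] p p, of "2 * i" "2 * i + 1"] i
      by (simp add: tr_def)
  qed
  have "inj_on tr (Pow {..<n})"
  proof (rule inj_onI)
    fix V W assume "V \<in> Pow {..<n}" "W \<in> Pow {..<n}" "tr V = tr W"
    then show "V = W" using tr[of V] tr[of W] by auto
  qed
  then have "2 ^ n = card (tr ` Pow {..<n})" by (simp add: card_image card_Pow)
  also have "\<dots> \<le> card {S. S \<subseteq> {..<2 * n} \<and> shatters (tr ` Pow {..<n}) S}"
    by (intro card_le_shattered) (auto simp: tr_def)
  finally have many: "2 ^ n \<le> card {S. S \<subseteq> {..<2 * n} \<and> shatters (tr ` Pow {..<n}) S}" .
  have "\<exists>S. S \<subseteq> {..<2 * n} \<and> shatters (tr ` Pow {..<n}) S \<and> d \<le> card S"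
  proof (rule ccontr)
    assume "\<not> ?thesis"
    then have "card {S. S \<subseteq> {..<2 * n} \<and> shatters (tr ` Pow {..<n}) S}
        \<le> card {S. S \<subseteq> {..<2 * n} \<and> card S < d}"
      by (intro card_mono) (auto simp: not_le)
    with many n card_small_subsets[of "2 * n" d] show False by linarith
  qed
  then obtain S where S: "S \<subseteq> {..<2 * n}" "shatters (tr ` Pow {..<n}) S" "d \<le> card S" by blast
  then have "finite S" using finite_subset by blast
  then obtain h where h: "bij_betw h {0..<card S} S" using ex_bij_betw_nat_finite by blast
  have hS: "h i \<in> S" if "i < d" for i using bij_betwE[OF h] that S(3) by auto
  have h_inj: "h i = h j \<longleftrightarrow> i = j" if "i < d" "j < d" for i j
    using bij_betw_imp_inj_on[OF h] that S(3) by (auto simp: inj_on_def)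
  show "\<exists>b. (\<forall>i<d. b i \<in> tuples M l) \<and>
      (\<forall>W\<subseteq>{..<d}. \<exists>c\<in>tuples M k. \<forall>i<d. holds M \<phi> (c @ b i) \<longleftrightarrow> i \<in> W)"
  proof (intro exI[of _ "\<lambda>i. p (h i)"] conjI allI impI)
    fix i assume "i < d"
    then show "p (h i) \<in> tuples M l" using hS S(1) p by blast
  next
    fix W assume W: "W \<subseteq> {..<d}"
    have "h ` W \<subseteq> S" using W hS by auto
    then have "\<exists>A\<in>tr ` Pow {..<n}. A \<inter> S = h ` W" using S(2) unfolding shatters_def by simp
    then obtain V where V: "V \<subseteq> {..<n}" "tr V \<inter> S = h ` W" by auto
    have "holds M \<phi> (c V @ p (h i)) \<longleftrightarrow> i \<in> W" if "i < d" for i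
    proof -
      have "holds M \<phi> (c V @ p (h i)) \<longleftrightarrow> h i \<in> tr V \<inter> S"
        using hS[OF that] S(1) by (auto simp: tr_def)
      also have "\<dots> \<longleftrightarrow> i \<in> W" unfolding V(2) using h_inj[OF that] W by auto
      finally show ?thesis .
    qed
    then show "\<exists>c\<in>tuples M k. \<forall>i<d. holds M \<phi> (c @ p (h i)) \<longleftrightarrow> i \<in> W"
      using c[OF V(1)] by blast
  qed
qed

lemma has_IP_diff_of_has_array:
  assumes \<phi>: "part_fm L k l \<phi>"
    and array: "has_array M (2 * l) (char_seq k (2 * l) (diff_fm k l \<phi>)) \<infinity> 2"
  shows "has_IP M k (2 * l) (diff_fm k l \<phi>)"
proof -
  let ?\<theta> = "diff_fm k l \<phi>"
  let ?P = "char_seq k (2 * l) ?\<theta>"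
  let ?I = "{(l :: nat, m :: nat). enat l < \<infinity> \<and> enat m < 2}"
  obtain a where a1: "\<forall>(i, m)\<in>?I. a i m \<in> tuples M (2 * l) \<and> seq_holds M ?P [a i m]"
    and a2: "\<forall>(i1, m1)\<in>?I. \<forall>(i2, m2)\<in>?I.
      seq_holds M ?P [a i1 m1, a i2 m2] \<longleftrightarrow> (i1 = i2 \<longrightarrow> m1 = m2)"
    and a3: "\<forall>is. is \<noteq> [] \<and> set is \<subseteq> ?I \<longrightarrow> (seq_holds M ?P (map (\<lambda>(l, m). a l m) is) \<longleftrightarrow>
      (\<forall>(i1, m1)\<in>set is. \<forall>(i2, m2)\<in>set is. seq_holds M ?P [a i1 m1, a i2 m2]))"
    using array unfolding has_array_def Let_def by (elim exE conjE)
  note P = seq_holds_char_seq[OF part_fm_diff_fm[OF \<phi>]]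
  have aT: "a i m \<in> tuples M (2 * l)" if "m < 2" for i m
    using a1 that by (auto simp: numeral_eq_enat)
  have pair: "seq_holds M ?P [a i1 m1, a i2 m2] \<longleftrightarrow> (i1 = i2 \<longrightarrow> m1 = m2)"
    if "m1 < 2" "m2 < 2" for i1 m1 i2 m2
    using a2 that by (auto simp: numeral_eq_enat)
  show ?thesis unfolding has_IP_def
  proof (intro allI exI[of _ "\<lambda>i. a i 0"] conjI impI)
    fix n W assume W: "W \<subseteq> {..<n::nat}"
    \<comment> \<open>The additional column \<open>n\<close> keeps the list nonempty when \<open>n = 0\<close>.\<close>
    let ?is = "map (\<lambda>i. (i, if i \<in> W then 0 else 1)) [0..<Suc n]"
    have sub: "set ?is \<subseteq> ?I" by (auto simp: numeral_eq_enat simp del: upt_Suc)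
    have "\<forall>(i1, m1)\<in>set ?is. \<forall>(i2, m2)\<in>set ?is. seq_holds M ?P [a i1 m1, a i2 m2]"
      by (auto simp: pair simp del: upt_Suc)
    then have "seq_holds M ?P (map (\<lambda>(l, m). a l m) ?is)"
      using a3[rule_format, of ?is] sub by (simp del: upt_Suc)
    then obtain c where c: "c \<in> tuples M k"
      "\<And>i. i \<le> n \<Longrightarrow> holds M ?\<theta> (c @ a i (if i \<in> W then 0 else 1))"
      by (subst (asm) P) (auto simp: aT simp del: upt_Suc)
    have "\<not> (holds M ?\<theta> (c @ a i 0) \<and> holds M ?\<theta> (c @ a i 1))" for i
    proof -
      have "\<not> seq_holds M ?P [a i 0, a i 1]" using pair[of 0 1 i i] by simp
      then show ?thesis using c(1) by (subst (asm) P) (auto simp: aT)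
    qed
    then have "holds M ?\<theta> (c @ a i 0) \<longleftrightarrow> i \<in> W" if "i < n" for i
      using c(2)[of i] that by (auto split: if_splits)
    then show "\<exists>c\<in>tuples M k. \<forall>i<n. holds M ?\<theta> (c @ a i 0) \<longleftrightarrow> i \<in> W" using c(1) by blast
  qed (simp add: aT)
qed

lemma has_array_of_has_IP:
  fixes M :: "('f, 'p, 'a) struct" and \<kappa> :: "'k rel"
  assumes sat: "saturated L \<kappa> M" "Cinfinite \<kappa>"
    and \<phi>: "part_fm L k l \<phi>" and IP: "has_IP M k l \<phi>"
  shows "has_array M (2 * l) (char_seq k (2 * l) (diff_fm k l \<phi>)) \<infinity> 2"
proof -
  let ?P = "char_seq k (2 * l) (diff_fm k l \<phi>)"
  obtain b where b: "\<And>i. b i \<in> tuples M l"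
    and shat: "\<And>n W. W \<subseteq> {..<n::nat} \<Longrightarrow> \<exists>c\<in>tuples M k. \<forall>i<n. holds M \<phi> (c @ b i) \<longleftrightarrow> i \<in> W"
    using has_IP_sequence[OF assms] by blast
  define a where "a i m = b (2 * i + m) @ b (2 * i + (1 - m))" for i m
  have aT: "a i m \<in> tuples M (2 * l)" for i m
    using b[of "2 * i + m"] b[of "2 * i + (1 - m)"] by (auto simp: a_def tuples_def)
  have \<theta>: "holds M (diff_fm k l \<phi>) (c @ a i m) \<longleftrightarrow>
      holds M \<phi> (c @ b (2 * i + m)) \<and> \<not> holds M \<phi> (c @ b (2 * i + (1 - m)))"
    if "c \<in> tuples M k" for c i m
    unfolding a_def by (rule holds_diff_fm[OF \<phi> that b b])
  note P = seq_holds_char_seq[OF part_fm_diff_fm[OF \<phi>]]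
  have Pa: "seq_holds M ?P (map (\<lambda>(l, m). a l m) is) \<longleftrightarrow>
      (\<exists>c\<in>tuples M k. \<forall>(i, m)\<in>set is. holds M (diff_fm k l \<phi>) (c @ a i m))" for "is"
    by (subst P) (auto simp: aT case_prod_unfold)
  have key: "seq_holds M ?P (map (\<lambda>(l, m). a l m) is) \<longleftrightarrow>
      (\<forall>(i1, m1)\<in>set is. \<forall>(i2, m2)\<in>set is. i1 = i2 \<longrightarrow> m1 = m2)"
    if I: "\<forall>(i, m)\<in>set is. m < 2" for "is"
  proof
    assume "seq_holds M ?P (map (\<lambda>(l, m). a l m) is)"
    then obtain c where "c \<in> tuples M k"
      and "\<And>i m. (i, m) \<in> set is \<Longrightarrow> holds M (diff_fm k l \<phi>) (c @ a i m)"
      unfolding Pa by fast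
    then have c: "holds M \<phi> (c @ b (2 * i + m))" "\<not> holds M \<phi> (c @ b (2 * i + (1 - m)))"
      if "(i, m) \<in> set is" for i m using that \<theta> by blast+
    have "m1 = m2" if "(i, m1) \<in> set is" "(i, m2) \<in> set is" for i m1 m2
    proof (rule ccontr)
      assume "m1 \<noteq> m2"
      moreover have "m1 < 2" "m2 < 2" using that I by auto
      ultimately have "m1 = 1 - m2" by linarith
      then show False using c(1)[OF that(1)] c(2)[OF that(2)] by simp
    qed
    then show "\<forall>(i1, m1)\<in>set is. \<forall>(i2, m2)\<in>set is. i1 = i2 \<longrightarrow> m1 = m2" by blast
  next
    assume free: "\<forall>(i1, m1)\<in>set is. \<forall>(i2, m2)\<in>set is. i1 = i2 \<longrightarrow> m1 = m2"
    \<comment> \<open>The indices at which the chosen pairs ask for \<open>\<phi>\<close>. The indices at which they ask for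
      \<open>\<not> \<phi>\<close> avoid this set, because no column occurs with both rows.\<close>
    let ?W = "(\<lambda>(i, m). 2 * i + m) ` set is"
    obtain n0 where n0: "\<forall>x\<in>?W. x \<le> n0" using finite_nat_set_iff_bounded_le by blast
    let ?n = "n0 + 2"
    obtain c where c: "c \<in> tuples M k" "\<forall>i<?n. holds M \<phi> (c @ b i) \<longleftrightarrow> i \<in> ?W"
      using shat[of ?W ?n] n0 by fastforce
    have "holds M (diff_fm k l \<phi>) (c @ a i m)" if im: "(i, m) \<in> set is" for i m
    proof -
      have "2 * i + m \<in> ?W" using im by force
      moreover from this have "2 * i + m < ?n" "2 * i + (1 - m) < ?n" using n0 by fastforce+
      moreover have "2 * i + (1 - m) \<notin> ?W"
      proof
        assume "2 * i + (1 - m) \<in> ?W"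
        then obtain i' m' where i': "(i', m') \<in> set is" "2 * i + (1 - m) = 2 * i' + m'" by auto
        have "m < 2" "m' < 2" using I im i'(1) by auto
        then have "i = i'" using i'(2) by linarith
        then have "m' = 1 - m" using i'(2) by simp
        moreover have "m = m'" using free im i'(1) \<open>i = i'\<close> by fast
        ultimately show False by arith
      qed
      ultimately show ?thesis using c \<theta> by blast
    qed
    then show "seq_holds M ?P (map (\<lambda>(l, m). a l m) is)"
      using c(1) unfolding Pa by blast
  qed
  have pair: "seq_holds M ?P [a i1 m1, a i2 m2] \<longleftrightarrow> (i1 = i2 \<longrightarrow> m1 = m2)"
    if "m1 < 2" "m2 < 2" for i1 m1 i2 m2
    using key[of "[(i1, m1), (i2, m2)]"] that by auto
  show ?thesis
    unfolding has_array_def Let_def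
  proof (intro exI[of _ a] conjI allI impI)
    let ?I = "{(l :: nat, m :: nat). enat l < \<infinity> \<and> enat m < 2}"
    have I: "?I = {(i, m). m < 2}" by (simp add: numeral_eq_enat)
    have "seq_holds M ?P [a i m]" if "m < 2" for i m
      using key[of "[(i, m)]"] that by auto
    then show "\<forall>(i, m)\<in>?I. a i m \<in> tuples M (2 * l) \<and> seq_holds M ?P [a i m]"
      unfolding I using aT by auto
    show "\<forall>(i1, m1)\<in>?I. \<forall>(i2, m2)\<in>?I.
        seq_holds M ?P [a i1 m1, a i2 m2] \<longleftrightarrow> (i1 = i2 \<longrightarrow> m1 = m2)"
      unfolding I using pair by auto
    fix "is" assume "is \<noteq> [] \<and> set is \<subseteq> ?I"
    then have lt: "\<forall>(i, m)\<in>set is. m < 2" unfolding I by auto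
    have "(\<forall>(i1, m1)\<in>set is. \<forall>(i2, m2)\<in>set is. seq_holds M ?P [a i1 m1, a i2 m2]) \<longleftrightarrow>
        (\<forall>(i1, m1)\<in>set is. \<forall>(i2, m2)\<in>set is. i1 = i2 \<longrightarrow> m1 = m2)"
      using bspec[OF lt] by (simp add: case_prod_unfold pair cong: ball_cong)
    with key[OF lt] show "seq_holds M ?P (map (\<lambda>(l, m). a l m) is) \<longleftrightarrow>
        (\<forall>(i1, m1)\<in>set is. \<forall>(i2, m2)\<in>set is. seq_holds M ?P [a i1 m1, a i2 m2])"
      by simp
  qed
qed

theorem claim4p5:
  fixes L :: "('f, 'p) lang"
    and T :: "('f, 'p) fm set"
    and M :: "('f, 'p, 'a) struct"
    and \<kappa> :: "'k rel"
    and k l :: nat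
    and \<phi> :: "('f, 'p) fm"
  assumes "complete_theory L T"
    and "models L M T"
    and "Cinfinite \<kappa>"
    and "saturated L \<kappa> M"
    and "part_fm L k l \<phi>"
  shows "(has_array M (2 * l) (char_seq k (2 * l) (diff_fm k l \<phi>)) \<infinity> 2 \<longleftrightarrow> has_IP M k l \<phi>) \<and>
         (has_IP M k l \<phi> \<longleftrightarrow> has_IP M k (2 * l) (diff_fm k l \<phi>))"
  using has_IP_diff_of_has_array[OF assms(5), of M] has_IP_of_has_IP_diff[OF assms(5), of M]
    has_array_of_has_IP[OF assms(4,3,5)]
  by blast

end
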